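(* Suppose that $A\in\mathbb{R}^{n\times n}$ satisfies the following property: for any $t\ge 0$ there exists an integer $k>0$ such that $$I+\frac{At}{\ell}\ \text{ is totally non-negative for any integer } \ell\ge k.$$ Then $A$ is an EP-matrix.
   Context: A matrix in $\mathbb{R}^{n\times n}$ is called a P-matrix if all its principal minors are positive. A matrix $A\in\mathbb{R}^{n\times n}$ is called an EP-matrix (exponential P-matrix) if $\exp(At)$ is a P-matrix for all $t\ge 0$. A matrix in $\mathbb{R}^{n\times n}$ is called totally non-negative (TN) if all its minors (of all orders $1,\dots,n$) are non-negative. *)

theory Defs
  imports
    Complex_Main
    Jordan_Normal_Form.Determinant
    Jordan_Normal_Form.DL_Submatrix
begin

text \<open>
  Real matrices are those of \<^typ>\<open>real mat\<close>, with rows and columns indexed by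
  \<open>{0..<n}\<close>. For \<open>I, J \<subseteq> {0..<n}\<close>, \<^term>\<open>submatrix A I J\<close> keeps the rows in \<open>I\<close> and the
  columns in \<open>J\<close>, both enumerated in increasing order. The minors of order \<open>k\<close> are therefore the
  determinants of \<^term>\<open>submatrix A I J\<close> with \<open>card I = card J = k\<close>, and the principal
  minors are those with \<open>I = J\<close>. The empty index set is excluded, so the orders are \<open>1, ..., n\<close>.
\<close>

definition P_matrix :: "real mat \<Rightarrow> bool" where
  "P_matrix A \<longleftrightarrow> square_mat A \<and>
     (\<forall>I. I \<noteq> {} \<and> I \<subseteq> {0..<dim_row A} \<longrightarrow> det (submatrix A I I) > 0)"

definition totally_nonneg :: "real mat \<Rightarrow> bool" where
  "totally_nonneg A \<longleftrightarrow> square_mat A \<and>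
     (\<forall>I J. I \<noteq> {} \<and> I \<subseteq> {0..<dim_row A} \<and> J \<subseteq> {0..<dim_col A} \<and> card I = card J \<longrightarrow>
        det (submatrix A I J) \<ge> 0)"

text \<open>
  The exponential is the power series of a square matrix, with convergence taken entrywise
  (\<^typ>\<open>real mat\<close> carries no topology). Lemma \<open>summable_mat_exp\<close> below shows that every one
  of these series converges.
\<close>

definition mat_exp :: "real mat \<Rightarrow> real mat" where
  "mat_exp A = mat (dim_row A) (dim_row A) (\<lambda>(i, j). \<Sum>k. (A ^\<^sub>m k) $$ (i, j) / fact k)"

definition EP_matrix :: "real mat \<Rightarrow> bool" where
  "EP_matrix A \<longleftrightarrow> square_mat A \<and> (\<forall>t::real. t \<ge> 0 \<longrightarrow> P_matrix (mat_exp (t \<cdot>\<^sub>m A)))"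

lemma summable_mat_exp:
  fixes A :: "real mat"
  assumes A: "A \<in> carrier_mat n n" and "i < n" "j < n"
  shows "summable (\<lambda>k. (A ^\<^sub>m k) $$ (i, j) / fact k)"
proof -
  define c where "c = Max (insert 0 ((\<lambda>(i, j). \<bar>A $$ (i, j)\<bar>) ` ({..<n} \<times> {..<n})))"
  have c: "\<bar>A $$ (i, j)\<bar> \<le> c" if "i < n" "j < n" for i j
    unfolding c_def using that by (intro Max_ge) auto
  have c0: "0 \<le> c"
    unfolding c_def by (intro Max_ge) auto
  have b: "\<bar>(A ^\<^sub>m k) $$ (i, j)\<bar> \<le> (real n * c) ^ k" if "i < n" "j < n" for i j k
    using that
  proof (induction k arbitrary: i j)
    case 0
    then show ?case using A by simp
  next
    case (Suc k)
    have Ak: "A ^\<^sub>m k \<in> carrier_mat n n"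
      using A by simp
    have "(A ^\<^sub>m Suc k) $$ (i, j) = (\<Sum>l<n. (A ^\<^sub>m k) $$ (i, l) * A $$ (l, j))"
      using A Ak Suc.prems by (simp add: scalar_prod_def atLeast0LessThan)
    then have "\<bar>(A ^\<^sub>m Suc k) $$ (i, j)\<bar> \<le> (\<Sum>l<n. \<bar>(A ^\<^sub>m k) $$ (i, l)\<bar> * \<bar>A $$ (l, j)\<bar>)"
      by (metis (no_types, lifting) abs_mult sum.cong sum_abs)
    also have "\<dots> \<le> (\<Sum>l<n. (real n * c) ^ k * c)"
      using Suc c c0 by (intro sum_mono mult_mono) auto
    also have "\<dots> = (real n * c) ^ Suc k"
      by simp
    finally show ?case .
  qed
  show ?thesis
  proof (rule summable_comparison_test')
    show "summable (\<lambda>k. (real n * c) ^ k / fact k)"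
      using summable_exp[of "real n * c"] by (simp add: divide_inverse mult.commute)
    show "norm ((A ^\<^sub>m k) $$ (i, j) / fact k) \<le> (real n * c) ^ k / fact k" if "k \<ge> 0" for k
      using b[OF assms(2,3), of k] by (simp add: divide_right_mono)
  qed
qed

end

theory Submission
  imports Defs
begin

text \<open>
  Let \<open>M\<^sub>l = I + tA/l\<close>, so that \<open>M\<^sub>l ^ l\<close> tends to \<open>exp (tA)\<close>. By the Cauchy-Binet formula, products of
  totally non-negative matrices are totally non-negative, and keeping only the diagonal term of
  the expansion of a principal minor gives \<open>det (M\<^sub>l ^ l)[S] \<ge> (det M\<^sub>l[S]) ^ l\<close>. Since
  \<open>det M\<^sub>l[S] = 1 + (t/l) r(t/l)\<close> for a polynomial \<open>r\<close>, the right-hand side tends to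
  \<open>exp (t r(0)) > 0\<close>, so the principal minors of \<open>exp (tA)\<close> are not merely non-negative but
  positive. Neither the invertibility of \<open>exp (tA)\<close> nor Fischer's inequality is needed.
\<close>

section \<open>Minors along index maps\<close>

text \<open>Rows and columns are picked by maps rather than by sets. Repetitions and arbitrary
  orders are thus allowed, so that the minor is alternating in both maps and sums can run over all
  maps.\<close>

definition minor :: "'a::comm_ring_1 mat \<Rightarrow> nat \<Rightarrow> (nat \<Rightarrow> nat) \<Rightarrow> (nat \<Rightarrow> nat) \<Rightarrow> 'a" where
  "minor M k f g = det (mat k k (\<lambda>(i, j). M $$ (f i, g j)))"

lemma minor_leibniz:
  "minor M k f g =
     (\<Sum>\<sigma> | \<sigma> permutes {0..<k}. signof \<sigma> * (\<Prod>i = 0..<k. M $$ (f i, g (\<sigma> i))))"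
  unfolding minor_def
  by (subst det_def'[of _ k], simp, intro sum.cong refl arg_cong2[where f = "(*)"] prod.cong)
     (auto dest: permutes_in_image)

lemma minor_cong:
  assumes "\<And>i. i < k \<Longrightarrow> f i = f' i" "\<And>i. i < k \<Longrightarrow> g i = g' i"
  shows "minor M k f g = minor M k f' g'"
  unfolding minor_def by (intro arg_cong[where f = det] eq_matI) (use assms in auto)

lemma minor_permute_rows:
  assumes "\<sigma> permutes {0..<k}"
  shows "minor M k (f \<circ> \<sigma>) g = signof \<sigma> * minor M k f g"
proof -
  have "mat k k (\<lambda>(i, j). M $$ ((f \<circ> \<sigma>) i, g j)) =
      mat k k (\<lambda>(i, j). mat k k (\<lambda>(i, j). M $$ (f i, g j)) $$ (\<sigma> i, j))"
    using permutes_in_image[OF assms] by (intro eq_matI) auto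
  then show ?thesis
    unfolding minor_def by (simp only: det_permute_rows[OF mat_carrier assms])
qed

text \<open>Transposing turns a permutation of columns into one of rows, to which
  \<open>det_permute_rows\<close> applies.\<close>

lemma minor_transpose: "minor M k f g = det (mat k k (\<lambda>(i, j). M $$ (f j, g i)))"
proof -
  have "mat k k (\<lambda>(i, j). M $$ (f j, g i)) = transpose_mat (mat k k (\<lambda>(i, j). M $$ (f i, g j)))"
    by (intro eq_matI) auto
  then show ?thesis
    unfolding minor_def by (simp only: det_transpose[OF mat_carrier])
qed

lemma minor_permute_cols:
  assumes "\<sigma> permutes {0..<k}"
  shows "minor M k f (g \<circ> \<sigma>) = signof \<sigma> * minor M k f g"
proof -
  have "mat k k (\<lambda>(i, j). M $$ (f j, (g \<circ> \<sigma>) i)) =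
      mat k k (\<lambda>(i, j). mat k k (\<lambda>(i, j). M $$ (f j, g i)) $$ (\<sigma> i, j))"
    using permutes_in_image[OF assms] by (intro eq_matI) auto
  then show ?thesis
    unfolding minor_transpose by (simp only: det_permute_rows[OF mat_carrier assms])
qed

lemma minor_not_inj_cols:
  assumes "\<not> inj_on g {0..<k}"
  shows "minor M k f g = 0"
proof -
  obtain i j where "i < k" "j < k" "i \<noteq> j" "g i = g j"
    using assms by (auto simp: inj_on_def)
  then show ?thesis
    unfolding minor_def
    by (intro det_identical_columns[OF mat_carrier, of i j]) (auto simp: col_def)
qed

section \<open>The Cauchy-Binet formula\<close>

lemma signof_mult_self: "signof \<sigma> * signof \<sigma> = (1 :: 'a::comm_ring_1)"
  by (simp add: sign_def)

text \<open>
  Summing over all maps \<open>g\<close> instead of over the increasing ones avoids sorting; every \<open>k\<close>-subset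
  is then counted \<open>k!\<close> times.
\<close>

lemma Cauchy_Binet:
  assumes M: "M \<in> carrier_mat a n" and N: "N \<in> carrier_mat n b"
    and f: "\<And>i. i < k \<Longrightarrow> f i < a" and h: "\<And>i. i < k \<Longrightarrow> h i < b"
  shows "fact k * minor (M * N) k f h =
    (\<Sum>g \<in> {0..<k} \<rightarrow>\<^sub>E {0..<n}. minor M k f g * minor N k g h)"
proof -
  let ?P = "{\<sigma>. \<sigma> permutes {0..<k}}" and ?G = "{0..<k} \<rightarrow>\<^sub>E {0..<n}"
  have finP: "finite ?P" by (simp add: finite_permutations)
  \<comment> \<open>Here only \<open>N\<close> has its terms collected into a minor.
    \<open>S\<close> equals the minor of the product, and each of the \<open>k!\<close> permutations
    in the Leibniz expansion of the minor of \<open>M\<close> contributes one further copy of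
    \<open>S\<close>.\<close>
  define S where "S = (\<Sum>g\<in>?G. (\<Prod>i = 0..<k. M $$ (f i, g i)) * minor N k g h)"
  have "minor (M * N) k f h =
      (\<Sum>\<sigma>\<in>?P. signof \<sigma> * (\<Prod>i = 0..<k. \<Sum>l\<in>{0..<n}. M $$ (f i, l) * N $$ (l, h (\<sigma> i))))"
    unfolding minor_leibniz
  proof (intro sum.cong refl arg_cong2[where f = "(*)"] prod.cong)
    fix \<sigma> i assume "\<sigma> \<in> ?P" "i \<in> {0..<k}"
    then have "f i < a" "h (\<sigma> i) < b"
      using f h permutes_in_image[of \<sigma> "{0..<k}" i] by auto
    then show "(M * N) $$ (f i, h (\<sigma> i)) = (\<Sum>l\<in>{0..<n}. M $$ (f i, l) * N $$ (l, h (\<sigma> i)))"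
      using M N by (simp add: scalar_prod_def)
  qed
  \<comment> \<open>Choosing one summation index \<open>l\<close> for each row \<open>i\<close>
    amounts to choosing a map \<open>g\<close>.\<close>
  also have "\<dots> = (\<Sum>\<sigma>\<in>?P. \<Sum>g\<in>?G.
      (\<Prod>i = 0..<k. M $$ (f i, g i)) * (signof \<sigma> * (\<Prod>i = 0..<k. N $$ (g i, h (\<sigma> i)))))"
    by (subst prod_sum_PiE) (auto simp: sum_distrib_left prod.distrib ac_simps)
  also have "\<dots> = S"
    unfolding S_def minor_leibniz sum_distrib_left by (rule sum.swap)
  finally have 1: "minor (M * N) k f h = S" .
  have "(\<Sum>g\<in>?G. minor M k f g * minor N k g h) =
      (\<Sum>\<sigma>\<in>?P. \<Sum>g\<in>?G. (\<Prod>i = 0..<k. M $$ (f i, g (\<sigma> i))) * (signof \<sigma> * minor N k g h))"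
    unfolding minor_leibniz[of M] sum_distrib_right
    by (subst sum.swap) (simp add: ac_simps)
  also have "\<dots> = (\<Sum>\<sigma>\<in>?P. S)"
  proof (rule sum.cong[OF refl])
    fix \<sigma> assume "\<sigma> \<in> ?P"
    then have \<sigma>: "\<sigma> permutes {0..<k}" by simp
    \<comment> \<open>\<open>g \<circ> \<sigma>\<close> remains extensional because
      \<open>\<sigma>\<close> fixes all indices outside \<open>{0..<k}\<close>. After reindexing,
      permuting the rows of \<open>N\<close> yields exactly the sign that came from expanding
      \<open>M\<close>.\<close>
    have "bij_betw (\<lambda>g. g \<circ> \<sigma>) ?G ?G"
    proof (rule bij_betw_byWitness[where f' = "\<lambda>g. g \<circ> inv_into UNIV \<sigma>"])
      have "g \<circ> \<tau> \<in> ?G" if "g \<in> ?G" "\<tau> permutes {0..<k}" for g \<tau>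
        using that permutes_in_image[OF that(2)]
        by (auto simp: PiE_def extensional_def Pi_def permutes_not_in)
      then show "(\<lambda>g. g \<circ> \<sigma>) ` ?G \<subseteq> ?G" "(\<lambda>g. g \<circ> inv_into UNIV \<sigma>) ` ?G \<subseteq> ?G"
        using \<sigma> permutes_inv[OF \<sigma>] by blast+
    qed (simp_all add: o_assoc[symmetric] permutes_inv_o[OF \<sigma>])
    then have "S = (\<Sum>g\<in>?G. (\<Prod>i = 0..<k. M $$ (f i, (g \<circ> \<sigma>) i)) * minor N k (g \<circ> \<sigma>) h)"
      unfolding S_def by (rule sum.reindex_bij_betw[symmetric])
    then show "(\<Sum>g\<in>?G. (\<Prod>i = 0..<k. M $$ (f i, g (\<sigma> i))) * (signof \<sigma> * minor N k g h)) = S"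
      by (simp add: minor_permute_rows[OF \<sigma>])
  qed
  also have "\<dots> = fact k * S"
    using card_permutations[of "{0..<k}" k] by simp
  finally show ?thesis
    using 1 by simp
qed

section \<open>Index sets and their increasing enumerations\<close>

lemma submatrix_minor:
  assumes "M \<in> carrier_mat n n" "I \<subseteq> {0..<n}" "J \<subseteq> {0..<n}" "card I = k" "card J = k"
  shows "det (submatrix M I J) = minor M k (pick I) (pick J)"
proof -
  have "{i. i < n \<and> i \<in> I} = I" "{i. i < n \<and> i \<in> J} = J" using assms by auto
  then show ?thesis
    using assms unfolding submatrix_def minor_def by simp
qed

lemma pick_less:
  assumes "I \<subseteq> {0..<n}" "i < card I"
  shows "pick I i < n"
  using pick_in_set_le[OF assms(2)] assms(1) by auto

lemma bij_betw_pick: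
  assumes I: "finite I"
  shows "bij_betw (pick I) {0..<card I} I"
proof -
  have inj: "inj_on (pick I) {0..<card I}"
    using pick_mono_le by (intro linorder_inj_onI) (auto, metis nat_neq_iff)
  have "pick I ` {0..<card I} \<subseteq> I"
    using pick_in_set_le by auto
  with inj I have "pick I ` {0..<card I} = I"
    by (intro card_subset_eq) (auto simp: card_image)
  with inj show ?thesis by (simp add: bij_betw_def)
qed

text \<open>An injective map lists its image in some order. Following it by the inverse of the
  increasing enumeration of the image gives the sorting permutation, extended by the
  identity.\<close>

lemma inj_pick_permutes:
  assumes "inj_on g {0..<k}"
  obtains \<sigma> where "\<sigma> permutes {0..<k}" "\<And>i. i < k \<Longrightarrow> g i = pick (g ` {0..<k}) (\<sigma> i)"
proof -
  let ?J = "g ` {0..<k}"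
  have card: "card ?J = k" using assms by (simp add: card_image)
  have p: "bij_betw (pick ?J) {0..<k} ?J"
    using bij_betw_pick[of ?J] card by simp
  define \<sigma> where "\<sigma> i = (if i < k then inv_into {0..<k} (pick ?J) (g i) else i)" for i
  have "bij_betw (inv_into {0..<k} (pick ?J) \<circ> g) {0..<k} {0..<k}"
    using assms by (intro bij_betw_trans[OF _ bij_betw_inv_into[OF p]]) (simp add: bij_betw_def)
  then have "bij_betw \<sigma> {0..<k} {0..<k}"
    by (rule bij_betw_cong[THEN iffD1, rotated]) (auto simp: \<sigma>_def)
  then have "\<sigma> permutes {0..<k}"
    by (rule bij_imp_permutes) (simp add: \<sigma>_def)
  moreover have "g i = pick ?J (\<sigma> i)" if "i < k" for i
    using that bij_betw_inv_into_right[OF p, of "g i"] by (simp add: \<sigma>_def)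
  ultimately show thesis by (rule that)
qed

section \<open>Products and powers of totally non-negative matrices\<close>

lemma totally_nonneg_minor:
  assumes M: "totally_nonneg M" "M \<in> carrier_mat n n"
    and IJ: "I \<subseteq> {0..<n}" "J \<subseteq> {0..<n}" "card I = k" "card J = k"
  shows "minor M k (pick I) (pick J) \<ge> 0"
proof (cases "I = {}")
  \<comment> \<open>\<open>totally_nonneg\<close> speaks of non-empty index sets only; here
    \<open>k = 0\<close> and the determinant is 1.\<close>
  case True
  then show ?thesis using IJ by (simp add: minor_def)
next
  case False
  then have "det (submatrix M I J) \<ge> 0"
    using M IJ unfolding totally_nonneg_def by auto
  then show ?thesis
    using submatrix_minor[OF M(2) IJ] by simp
qed

text \<open>Sorting \<open>g\<close> multiplies both factors by the same sign.\<close>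

lemma minor_mult_minor_nonneg:
  assumes M: "totally_nonneg M" "M \<in> carrier_mat n n" and N: "totally_nonneg N" "N \<in> carrier_mat n n"
    and IJ: "I \<subseteq> {0..<n}" "J \<subseteq> {0..<n}" "card I = k" "card J = k"
    and g: "g \<in> {0..<k} \<rightarrow> {0..<n}"
  shows "minor M k (pick I) g * minor N k g (pick J) \<ge> 0"
proof (cases "inj_on g {0..<k}")
  case False
  then show ?thesis by (simp add: minor_not_inj_cols)
next
  case True
  let ?S = "g ` {0..<k}"
  obtain \<sigma> where \<sigma>: "\<sigma> permutes {0..<k}" "\<And>i. i < k \<Longrightarrow> g i = (pick ?S \<circ> \<sigma>) i"
    using inj_pick_permutes[OF True] by auto
  have S: "?S \<subseteq> {0..<n}" "card ?S = k"
    using g True by (auto simp: card_image)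
  have "minor M k (pick I) g = signof \<sigma> * minor M k (pick I) (pick ?S)"
    using minor_cong[of k "pick I" "pick I" g, OF refl \<sigma>(2)] minor_permute_cols[OF \<sigma>(1)] by metis
  moreover have "minor N k g (pick J) = signof \<sigma> * minor N k (pick ?S) (pick J)"
    using minor_cong[of k g _ "pick J" "pick J", OF \<sigma>(2) refl] minor_permute_rows[OF \<sigma>(1)] by metis
  ultimately have "minor M k (pick I) g * minor N k g (pick J) =
      (signof \<sigma> * signof \<sigma>) * (minor M k (pick I) (pick ?S) * minor N k (pick ?S) (pick J))"
    by (simp only: ac_simps)
  then show ?thesis
    using totally_nonneg_minor[OF M IJ(1) S(1) IJ(3) S(2)] totally_nonneg_minor[OF N S(1) IJ(2) S(2) IJ(4)]
    by (simp only: signof_mult_self) simp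
qed

text \<open>Every term of the Cauchy-Binet sum is non-negative, and dividing by \<open>k!\<close>
  keeps the sign.\<close>

lemma totally_nonneg_mult:
  assumes M: "totally_nonneg M" "M \<in> carrier_mat n n" and N: "totally_nonneg N" "N \<in> carrier_mat n n"
  shows "totally_nonneg (M * N)"
proof -
  have "det (submatrix (M * N) I J) \<ge> 0"
    if "I \<subseteq> {0..<n}" "J \<subseteq> {0..<n}" "card I = card J" for I J
  proof -
    let ?k = "card I"
    have "0 \<le> (\<Sum>g \<in> {0..<?k} \<rightarrow>\<^sub>E {0..<n}. minor M ?k (pick I) g * minor N ?k g (pick J))"
      using that by (intro sum_nonneg minor_mult_minor_nonneg[OF M N]) auto
    also have "\<dots> = fact ?k * minor (M * N) ?k (pick I) (pick J)"
      using that by (intro Cauchy_Binet[OF M(2) N(2), symmetric]) (auto intro: pick_less)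
    finally have "minor (M * N) ?k (pick I) (pick J) \<ge> 0"
      using mult_le_cancel_left_pos[of "fact ?k :: real" 0] by simp
    then show ?thesis
      using that M N by (simp add: submatrix_minor[OF mult_carrier_mat])
  qed
  then show ?thesis
    using M N by (auto simp: totally_nonneg_def)
qed

text \<open>
  In the Cauchy-Binet sum, the \<open>k!\<close> rearrangements of \<open>I\<close> contribute \<open>det M[I] * det N[I]\<close> each, and
  all other terms are non-negative.
\<close>

lemma principal_minor_mult_ge:
  assumes M: "totally_nonneg M" "M \<in> carrier_mat n n" and N: "totally_nonneg N" "N \<in> carrier_mat n n"
    and I: "I \<subseteq> {0..<n}"
  shows "det (submatrix (M * N) I I) \<ge> det (submatrix M I I) * det (submatrix N I I)"
proof -
  let ?k = "card I" and ?P = "{\<sigma>. \<sigma> permutes {0..<card I}}"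
  let ?G = "{0..<?k} \<rightarrow>\<^sub>E {0..<n}"
  let ?t = "\<lambda>g. minor M ?k (pick I) g * minor N ?k g (pick I)"
  \<comment> \<open>The rearrangement of \<open>I\<close> by \<open>\<sigma>\<close>, restricted so
    that it belongs to the extensional maps \<open>?G\<close>.\<close>
  define e where "e \<sigma> = restrict (pick I \<circ> \<sigma>) {0..<?k}" for \<sigma>
  have p: "bij_betw (pick I) {0..<?k} I"
    using I finite_subset by (intro bij_betw_pick) auto
  have inj: "inj_on e ?P"
  proof (rule inj_onI)
    fix \<sigma> \<tau> assume \<sigma>\<tau>: "\<sigma> \<in> ?P" "\<tau> \<in> ?P" and eq: "e \<sigma> = e \<tau>"
    show "\<sigma> = \<tau>"
    proof
      fix i
      show "\<sigma> i = \<tau> i"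
      proof (cases "i < ?k")
        case True
        have "pick I (\<sigma> i) = pick I (\<tau> i)"
          using fun_cong[OF eq, of i] True by (simp add: e_def)
        moreover have "\<sigma> i \<in> {0..<?k}" "\<tau> i \<in> {0..<?k}"
          using \<sigma>\<tau> True permutes_in_image[of _ "{0..<?k}" i] by auto
        ultimately show ?thesis
          using p by (auto simp: bij_betw_def dest: inj_onD)
      next
        case False
        then show ?thesis using \<sigma>\<tau> by (auto simp: permutes_def)
      qed
    qed
  qed
  have e: "e \<sigma> \<in> ?G" "?t (e \<sigma>) = ?t (pick I)" if "\<sigma> \<in> ?P" for \<sigma>
  proof -
    have \<sigma>: "\<sigma> permutes {0..<?k}" using that by simp
    show "e \<sigma> \<in> ?G"
      using permutes_in_image[OF \<sigma>] pick_less[OF I] by (auto simp: e_def)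
    have "?t (e \<sigma>) = ?t (pick I \<circ> \<sigma>)"
      by (intro arg_cong2[where f = "(*)"] minor_cong) (auto simp: e_def)
    also have "\<dots> = (signof \<sigma> * signof \<sigma>) * ?t (pick I)"
      by (simp only: minor_permute_cols[OF \<sigma>] minor_permute_rows[OF \<sigma>] ac_simps)
    finally show "?t (e \<sigma>) = ?t (pick I)"
      by (simp only: signof_mult_self mult_1)
  qed
  have "fact ?k * ?t (pick I) = (\<Sum>\<sigma>\<in>?P. ?t (e \<sigma>))"
    using card_permutations[of "{0..<?k}" ?k] e(2) by simp
  also have "\<dots> = (\<Sum>g\<in>e ` ?P. ?t g)"
    using inj by (simp add: sum.reindex)
  also have "\<dots> \<le> (\<Sum>g\<in>?G. ?t g)"
    using e(1) I by (intro sum_mono2 minor_mult_minor_nonneg[OF M N]) (auto intro: finite_PiE)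
  also have "\<dots> = fact ?k * minor (M * N) ?k (pick I) (pick I)"
    using I by (intro Cauchy_Binet[OF M(2) N(2), symmetric]) (auto intro: pick_less)
  finally show ?thesis
    using M N mult_carrier_mat[OF M(2) N(2)] by (simp add: submatrix_minor[OF _ I I refl refl])
qed

lemma submatrix_one:
  assumes "I \<subseteq> {0..<n}"
  shows "submatrix (1\<^sub>m n) I I = 1\<^sub>m (card I)"
proof -
  have I: "{i. i < n \<and> i \<in> I} = I" using assms by auto
  have "bij_betw (pick I) {0..<card I} I"
    using assms finite_subset by (intro bij_betw_pick) auto
  then have "pick I i = pick I j \<longleftrightarrow> i = j" if "i < card I" "j < card I" for i j
    using that by (auto simp: bij_betw_def dest: inj_onD)
  then show ?thesis
    using I assms by (intro eq_matI) (auto simp: submatrix_def pick_less)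
qed

text \<open>Both claims go through one induction, as \<open>principal_minor_mult_ge\<close> asks for
  total non-negativity of the power as well. Starting at \<open>l = 1\<close> makes the base case
  the hypothesis on \<open>M\<close>.\<close>

lemma principal_minor_pow_ge:
  assumes M: "totally_nonneg M" "M \<in> carrier_mat n n" and I: "I \<subseteq> {0..<n}" and "l > 0"
  shows "totally_nonneg (M ^\<^sub>m l) \<and> det (submatrix (M ^\<^sub>m l) I I) \<ge> det (submatrix M I I) ^ l"
  using \<open>l > 0\<close>
proof (induction l rule: nat_induct_non_zero)
  case 1
  then show ?case using M by simp
next
  case (Suc l)
  have Ml: "M ^\<^sub>m l \<in> carrier_mat n n" using M by simp
  have nonneg: "det (submatrix M I I) \<ge> 0"
    using totally_nonneg_minor[OF M I I refl refl] submatrix_minor[OF M(2) I I refl refl] by simp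
  have "det (submatrix M I I) ^ Suc l \<le> det (submatrix (M ^\<^sub>m l) I I) * det (submatrix M I I)"
    using Suc.IH nonneg by (simp add: mult.commute mult_left_mono)
  also have "\<dots> \<le> det (submatrix (M ^\<^sub>m Suc l) I I)"
    using principal_minor_mult_ge[OF _ Ml M I] Suc.IH by simp
  finally show ?case
    using totally_nonneg_mult[OF _ Ml M] Suc.IH by simp
qed

section \<open>Determinants near the identity and a positivity criterion for limits\<close>

text \<open>Evaluation at \<open>x\<close> is a ring homomorphism, so it commutes with the
  determinant of a matrix of linear polynomials. The constant coefficient is the value at 0, the
  determinant of the identity.\<close>

lemma det_affine_poly:
  assumes B: "B \<in> carrier_mat m m"
  obtains r :: "real poly" where "\<And>x. det (1\<^sub>m m + x \<cdot>\<^sub>m B) = 1 + x * poly r x"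
proof -
  define Q where "Q = mat m m (\<lambda>(i, j). [:(1\<^sub>m m :: real mat) $$ (i, j), B $$ (i, j):])"
  have Q: "det (1\<^sub>m m + x \<cdot>\<^sub>m B) = poly (det Q) x" for x
  proof -
    interpret comm_ring_hom "\<lambda>p. poly p x" by unfold_locales auto
    have "1\<^sub>m m + x \<cdot>\<^sub>m B = map_mat (\<lambda>p. poly p x) Q"
      using B by (intro eq_matI) (auto simp: Q_def)
    then show ?thesis by simp
  qed
  obtain c r where cr: "det Q = pCons c r" by (cases "det Q")
  have "c = 1"
  proof -
    have "1\<^sub>m m + 0 \<cdot>\<^sub>m B = 1\<^sub>m m"
      using B by (intro eq_matI) auto
    then show ?thesis using Q[of 0] cr by simp
  qed
  then show thesis
    using Q cr by (intro that[of r]) simp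
qed

text \<open>Eventually \<open>u l\<close> exceeds the constant \<open>c - 1\<close>, and for a
  constant the powers have the known limit \<open>exp (c - 1)\<close>, which bounds \<open>L\<close>
  from below.\<close>

lemma limit_pos_if_power_le:
  fixes u :: "nat \<Rightarrow> real"
  assumes u: "u \<longlonglongrightarrow> c" and f: "f \<longlonglongrightarrow> L"
    and le: "eventually (\<lambda>l. (1 + u l / real l) ^ l \<le> f l) sequentially"
  shows "L > 0"
proof -
  have ev: "eventually (\<lambda>l. u l \<ge> c - 1) sequentially"
    using order_tendstoD(1)[OF u, of "c - 1"] by (auto elim: eventually_mono)
  \<comment> \<open>For \<open>l > \<bar>c - 1\<bar>\<close> the smaller base is non-negative, as
    monotonicity of the power requires.\<close>
  have "eventually (\<lambda>l. (1 + (c - 1) / real l) ^ l \<le> f l) sequentially"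
    using ev le eventually_gt_at_top[of "nat \<lceil>\<bar>c - 1\<bar>\<rceil>"]
  proof eventually_elim
    case (elim l)
    then have "\<bar>c - 1\<bar> < real l" by linarith
    then have "0 \<le> 1 + (c - 1) / real l"
      by (cases "l = 0") (auto simp: field_simps)
    then have "(1 + (c - 1) / real l) ^ l \<le> (1 + u l / real l) ^ l"
      using elim by (intro power_mono add_left_mono divide_right_mono) auto
    with elim show ?case by linarith
  qed
  then have "exp (c - 1) \<le> L"
    by (rule tendsto_le[OF sequentially_bot f tendsto_exp_limit_sequentially])
  then show ?thesis
    using exp_gt_zero[of "c - 1"] by linarith
qed

section \<open>Convergence to the matrix exponential\<close>

text \<open>The binomial theorem, valid because the identity commutes with \<open>A\<close>. It is
  proved entrywise by induction on \<open>l\<close> with Pascal's rule.\<close>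

lemma one_plus_smult_pow_index:
  fixes A :: "real mat"
  assumes A: "A \<in> carrier_mat n n" and "i < n" "j < n"
  shows "((1\<^sub>m n + c \<cdot>\<^sub>m A) ^\<^sub>m l) $$ (i, j) = (\<Sum>k\<le>l. real (l choose k) * c ^ k * (A ^\<^sub>m k) $$ (i, j))"
  using assms(2,3)
proof (induction l arbitrary: i j)
  case 0
  then show ?case using A by simp
next
  case (Suc l)
  let ?M = "1\<^sub>m n + c \<cdot>\<^sub>m A"
  let ?a = "\<lambda>k i j. (A ^\<^sub>m k) $$ (i, j)"
  have M: "?M \<in> carrier_mat n n" "?M ^\<^sub>m l \<in> carrier_mat n n" using A by auto
  have step: "?a (Suc k) i j = (\<Sum>s = 0..<n. ?a k i s * A $$ (s, j))" for k
    using A Suc.prems pow_carrier_mat[OF A, of k] by (simp add: scalar_prod_def)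
  have "(?M ^\<^sub>m Suc l) $$ (i, j) = (\<Sum>s = 0..<n. (?M ^\<^sub>m l) $$ (i, s) * ?M $$ (s, j))"
    using M Suc.prems by (simp add: scalar_prod_def del: index_add_mat)
  also have "\<dots> = (\<Sum>s = 0..<n. (?M ^\<^sub>m l) $$ (i, s) * (if s = j then 1 else 0) +
      c * ((?M ^\<^sub>m l) $$ (i, s) * A $$ (s, j)))"
    using A Suc.prems by (intro sum.cong) (auto simp: algebra_simps)
  also have "\<dots> = (?M ^\<^sub>m l) $$ (i, j) + c * (\<Sum>s = 0..<n. (?M ^\<^sub>m l) $$ (i, s) * A $$ (s, j))"
    using Suc.prems by (simp add: sum.distrib sum_distrib_left if_distrib[of "(*) _"] cong: if_cong)
  also have "(\<Sum>s = 0..<n. (?M ^\<^sub>m l) $$ (i, s) * A $$ (s, j)) =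
      (\<Sum>s = 0..<n. \<Sum>k\<le>l. real (l choose k) * c ^ k * (?a k i s * A $$ (s, j)))"
    using Suc by (intro sum.cong) (auto simp: sum_distrib_right sum_distrib_left ac_simps)
  also have "\<dots> = (\<Sum>k\<le>l. real (l choose k) * c ^ k * ?a (Suc k) i j)"
    unfolding step sum_distrib_left by (rule sum.swap)
  also have "(?M ^\<^sub>m l) $$ (i, j) = ?a 0 i j + (\<Sum>k<l. real (l choose Suc k) * c ^ Suc k * ?a (Suc k) i j)"
    using Suc by (simp add: sum.atMost_shift del: pow_mat.simps(2))
  \<comment> \<open>The added term \<open>k = l\<close> vanishes since
    \<open>l choose Suc l = 0\<close>. Both sums now have the same range, and Pascal's rule merges
    them.\<close>
  also have "(\<Sum>k<l. real (l choose Suc k) * c ^ Suc k * ?a (Suc k) i j) =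
      (\<Sum>k\<le>l. real (l choose Suc k) * c ^ Suc k * ?a (Suc k) i j)"
    by (simp add: lessThan_Suc_atMost[symmetric] binomial_eq_0 del: pow_mat.simps(2))
  finally have "(?M ^\<^sub>m Suc l) $$ (i, j) =
      ?a 0 i j + (\<Sum>k\<le>l. real (Suc l choose Suc k) * c ^ Suc k * ?a (Suc k) i j)"
    by (simp add: sum_distrib_left sum.distrib[symmetric] algebra_simps del: pow_mat.simps(2))
  also have "\<dots> = (\<Sum>k\<le>Suc l. real (Suc l choose k) * c ^ k * ?a k i j)"
    by (subst sum.atMost_Suc_shift) (simp del: pow_mat.simps(2) binomial_Suc_Suc)
  finally show ?case .
qed

text \<open>\<open>p k\<close> is the product of the factors \<open>1 - j/l\<close> over
  \<open>j < k\<close>. Each factor increases the defect \<open>1 - p k\<close> by at most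
  \<open>j/l\<close>, and these increments add up to at most \<open>k^2/l\<close>.\<close>

lemma binomial_div_power_bounds:
  assumes "l > 0"
  defines "p \<equiv> \<lambda>k. real (l choose k) * fact k / real l ^ k"
  shows "0 \<le> p k \<and> p k \<le> 1 \<and> 1 - p k \<le> (real k)\<^sup>2 / real l"
proof (induction k)
  case 0
  then show ?case by (simp add: p_def)
next
  case (Suc k)
  \<comment> \<open>For \<open>k > l\<close> both sides are 0; for \<open>k = l\<close> the new
    factor is 0.\<close>
  have step: "p (Suc k) = p k * (1 - real k / real l)"
  proof (cases "k \<le> l")
    case True
    have "real (Suc k * (l choose Suc k)) = real ((l - k) * (l choose k))"
      by (simp only: binomial_absorb_comp binomial_absorption)
    then have "real (Suc k) * real (l choose Suc k) = (real l - real k) * real (l choose k)"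
      using True by (simp only: of_nat_mult of_nat_diff)
    then have "real (l choose Suc k) * fact (Suc k) = (real l - real k) * real (l choose k) * fact k"
      by (simp add: mult.commute mult.left_commute)
    then show ?thesis
      using \<open>l > 0\<close> by (simp add: p_def field_simps)
  qed (simp add: p_def binomial_eq_0)
  have nn: "0 \<le> p (Suc k)" by (simp add: p_def)
  have "p k * (real k / real l) \<ge> 0" "p k * (real k / real l) \<le> real k / real l"
    using Suc.IH by (simp, intro mult_left_le_one_le) auto
  moreover have "real k / real l + (real k)\<^sup>2 / real l \<le> (real (Suc k))\<^sup>2 / real l"
    unfolding add_divide_distrib[symmetric]
    by (intro divide_right_mono) (auto simp: power2_eq_square algebra_simps)
  ultimately show ?case
    using nn Suc.IH unfolding step right_diff_distrib mult_1_right by linarith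
qed

lemma smult_smult: "a \<cdot>\<^sub>m (b \<cdot>\<^sub>m M) = (a * b :: 'a::semigroup_mult) \<cdot>\<^sub>m M"
  by (intro eq_matI) (auto simp: mult.assoc)

lemma pow_mat_smult:
  fixes A :: "real mat"
  assumes "A \<in> carrier_mat n n"
  shows "(c \<cdot>\<^sub>m A) ^\<^sub>m k = c ^ k \<cdot>\<^sub>m (A ^\<^sub>m k)"
proof (induction k)
  case 0
  then show ?case using assms by auto
next
  case (Suc k)
  then show ?case
    using assms pow_carrier_mat[OF assms, of k]
    by (auto simp: mult_smult_distrib mult_smult_assoc_mat)
qed

text \<open>The binomial sum is the exponential series with its terms \<open>a k\<close> weighted by
  \<open>p k\<close>. As \<open>p k\<close> differs from 1 by at most
  \<open>k^2/l \<le> 4^k/l\<close>, the total error is at most a constant over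
  \<open>l\<close>.\<close>

lemma one_plus_div_pow_tendsto_mat_exp:
  fixes A :: "real mat"
  assumes A: "A \<in> carrier_mat n n" and ij: "i < n" "j < n"
  shows "(\<lambda>l. ((1\<^sub>m n + (1 / real l) \<cdot>\<^sub>m A) ^\<^sub>m l) $$ (i, j)) \<longlonglongrightarrow> mat_exp A $$ (i, j)"
proof -
  define a where "a k = (A ^\<^sub>m k) $$ (i, j) / fact k" for k
  \<comment> \<open>This is the entry series of the exponential of
    \<open>x \<cdot>\<^sub>m A\<close>. Convergence at 5 then gives absolute convergence at
    4.\<close>
  have "summable (\<lambda>k. a k * x ^ k)" for x
    using summable_mat_exp[of "x \<cdot>\<^sub>m A" n i j] A ij
    by (simp add: a_def pow_mat_smult[OF A] mult.commute)
  then have sum4: "summable (\<lambda>k. \<bar>a k * 4 ^ k\<bar>)"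
    using powser_insidea[of a 5 4] by simp
  have suma: "summable a"
    using summable_mat_exp[OF A ij] unfolding a_def .
  have sq: "(real k)\<^sup>2 \<le> 4 ^ k" for k
  proof -
    have "real k ^ 2 \<le> (2 ^ k) ^ 2"
      by (intro power_mono) (use of_nat_less_two_power[of k, where ?'a = real] in auto)
    then show ?thesis by (simp add: power_mult[symmetric] mult.commute[of k] power_mult)
  qed
  have bound: "\<bar>((1\<^sub>m n + (1 / real l) \<cdot>\<^sub>m A) ^\<^sub>m l) $$ (i, j) - mat_exp A $$ (i, j)\<bar>
      \<le> (\<Sum>k. \<bar>a k * 4 ^ k\<bar>) / real l" if "l > 0" for l
  proof -
    define p where "p k = real (l choose k) * fact k / real l ^ k" for k
    have p: "\<bar>p k - 1\<bar> \<le> 4 ^ k / real l" for k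
      using binomial_div_power_bounds[OF that, of k] divide_right_mono[OF sq[of k], of "real l"]
      unfolding p_def[symmetric] by simp
    have "((1\<^sub>m n + (1 / real l) \<cdot>\<^sub>m A) ^\<^sub>m l) $$ (i, j) = (\<Sum>k\<le>l. p k * a k)"
      unfolding one_plus_smult_pow_index[OF A ij] by (simp add: p_def a_def power_divide)
    \<comment> \<open>The weights vanish for \<open>k > l\<close>, so the finite sum can be
      subtracted from the exponential series term by term.\<close>
    moreover have "(\<lambda>k. p k * a k) sums (\<Sum>k\<le>l. p k * a k)"
      by (rule sums_finite) (auto simp: p_def binomial_eq_0)
    moreover have "a sums (mat_exp A $$ (i, j))"
      using summable_sums[OF suma] A ij by (simp add: mat_exp_def a_def[abs_def])
    ultimately have s: "(\<lambda>k. p k * a k - a k) sums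
        (((1\<^sub>m n + (1 / real l) \<cdot>\<^sub>m A) ^\<^sub>m l) $$ (i, j) - mat_exp A $$ (i, j))"
      using sums_diff by simp
    have le: "\<bar>p k * a k - a k\<bar> \<le> \<bar>a k * 4 ^ k\<bar> / real l" for k
    proof -
      have "\<bar>p k * a k - a k\<bar> = \<bar>p k - 1\<bar> * \<bar>a k\<bar>"
        by (simp add: abs_mult[symmetric] algebra_simps)
      also have "\<dots> \<le> 4 ^ k / real l * \<bar>a k\<bar>"
        using p by (intro mult_right_mono) auto
      finally show ?thesis by (simp add: abs_mult mult.commute)
    qed
    have "norm (\<Sum>k. p k * a k - a k) \<le> (\<Sum>k. \<bar>a k * 4 ^ k\<bar> / real l)"
      using le by (intro norm_suminf_le summable_divide sum4) auto
    then show ?thesis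
      using sums_unique[OF s] suminf_divide[OF sum4, of "real l"] by simp
  qed
  have "(\<lambda>l. (\<Sum>k. \<bar>a k * 4 ^ k\<bar>) / real l) \<longlonglongrightarrow> 0"
    by (rule lim_const_over_n)
  then have "(\<lambda>l. ((1\<^sub>m n + (1 / real l) \<cdot>\<^sub>m A) ^\<^sub>m l) $$ (i, j) - mat_exp A $$ (i, j)) \<longlonglongrightarrow> 0"
  proof (rule tendsto_0_le[where K = 1])
    have "norm (((1\<^sub>m n + (1 / real l) \<cdot>\<^sub>m A) ^\<^sub>m l) $$ (i, j) - mat_exp A $$ (i, j))
        \<le> norm ((\<Sum>k. \<bar>a k * 4 ^ k\<bar>) / real l) * 1" if "l > 0" for l
      unfolding real_norm_def mult_1_right by (rule order_trans[OF bound[OF that] abs_ge_self])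
    then show "eventually (\<lambda>l. norm (((1\<^sub>m n + (1 / real l) \<cdot>\<^sub>m A) ^\<^sub>m l) $$ (i, j) - mat_exp A $$ (i, j))
        \<le> norm ((\<Sum>k. \<bar>a k * 4 ^ k\<bar>) / real l) * 1) sequentially"
      using eventually_gt_at_top[of 0] by (rule eventually_mono[rotated])
  qed
  then show ?thesis
    by (rule LIM_zero_cancel)
qed

section \<open>Passage to the limit in the principal minors\<close>

text \<open>By the Leibniz formula a minor is a polynomial in the selected entries.\<close>

lemma tendsto_minor:
  fixes M :: "'b \<Rightarrow> real mat"
  assumes "\<And>i j. i < k \<Longrightarrow> j < k \<Longrightarrow> ((\<lambda>l. M l $$ (f i, g j)) \<longlongrightarrow> L $$ (f i, g j)) F"
  shows "((\<lambda>l. minor (M l) k f g) \<longlongrightarrow> minor L k f g) F"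
  unfolding minor_leibniz
proof (intro tendsto_sum tendsto_mult tendsto_const tendsto_prod)
  fix \<sigma> i assume "\<sigma> \<in> {\<sigma>. \<sigma> permutes {0..<k}}" "i \<in> {0..<k}"
  then show "((\<lambda>l. M l $$ (f i, g (\<sigma> i))) \<longlongrightarrow> L $$ (f i, g (\<sigma> i))) F"
    using assms permutes_in_image[of \<sigma> "{0..<k}" i] by simp
qed

theorem theorem10:
  fixes A :: "real mat" and n :: nat
  assumes "A \<in> carrier_mat n n"
    and "\<And>t::real. t \<ge> 0 \<Longrightarrow>
           \<exists>k::nat. k > 0 \<and> (\<forall>l\<ge>k. totally_nonneg (1\<^sub>m n + (t / real l) \<cdot>\<^sub>m A))"
  shows "EP_matrix A"
proof -
  have "det (submatrix (mat_exp (t \<cdot>\<^sub>m A)) I I) > 0" if "t \<ge> 0" and I: "I \<subseteq> {0..<n}" for t I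
  proof -
    obtain k0 where k0: "k0 > 0" "\<And>l. l \<ge> k0 \<Longrightarrow> totally_nonneg (1\<^sub>m n + (t / real l) \<cdot>\<^sub>m A)"
      using assms(2)[OF \<open>t \<ge> 0\<close>] by blast
    let ?M = "\<lambda>l. 1\<^sub>m n + (t / real l) \<cdot>\<^sub>m A" and ?k = "card I"
    let ?E = "mat_exp (t \<cdot>\<^sub>m A)"
    note A = assms(1)
    have M: "?M l \<in> carrier_mat n n" for l using A by simp
    have E: "?E \<in> carrier_mat n n" using A by (simp add: mat_exp_def)
    have I': "{i. i < n \<and> i \<in> I} = I" using I by auto
    \<comment> \<open>A principal submatrix of the identity is again an identity, so
      \<open>?M l\<close> keeps its affine form and \<open>det_affine_poly\<close> applies with
      \<open>x = t/l\<close>.\<close>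
    have sub: "submatrix (?M l) I I = 1\<^sub>m ?k + (t / real l) \<cdot>\<^sub>m submatrix A I I" for l
      unfolding submatrix_one[OF I, symmetric]
      using A I' pick_less[OF I] by (intro eq_matI) (auto simp: submatrix_def)
    have "submatrix A I I \<in> carrier_mat ?k ?k"
      using A I' by (auto simp: submatrix_def)
    then obtain r where r: "\<And>x. det (1\<^sub>m ?k + x \<cdot>\<^sub>m submatrix A I I) = 1 + x * poly r x"
      by (rule det_affine_poly) blast
    have "(\<lambda>l. t / real l) \<longlonglongrightarrow> 0" by (rule lim_const_over_n)
    \<comment> \<open>With \<open>x = t/l\<close>, the principal minor
      \<open>1 + x * poly r x\<close> is 1 plus this sequence divided by \<open>l\<close>, the form
      that \<open>limit_pos_if_power_le\<close> expects.\<close>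
    then have u: "(\<lambda>l. t * poly r (t / real l)) \<longlonglongrightarrow> t * poly r 0"
      by (intro tendsto_intros)
    have "(\<lambda>l. minor (?M l ^\<^sub>m l) ?k (pick I) (pick I)) \<longlonglongrightarrow> minor ?E ?k (pick I) (pick I)"
    proof (rule tendsto_minor)
      fix i j assume "i < ?k" "j < ?k"
      then show "(\<lambda>l. (?M l ^\<^sub>m l) $$ (pick I i, pick I j)) \<longlonglongrightarrow> ?E $$ (pick I i, pick I j)"
        using one_plus_div_pow_tendsto_mat_exp[of "t \<cdot>\<^sub>m A" n "pick I i" "pick I j"] A pick_less[OF I]
        by (simp add: smult_smult)
    qed
    then have "(\<lambda>l. det (submatrix (?M l ^\<^sub>m l) I I)) \<longlonglongrightarrow> det (submatrix ?E I I)"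
      using pow_carrier_mat[OF M] E by (simp add: submatrix_minor[OF _ I I refl refl])
    \<comment> \<open>\<open>k0 > 0\<close> supplies the \<open>l > 0\<close> required by
      \<open>principal_minor_pow_ge\<close>.\<close>
    moreover have "eventually (\<lambda>l. (1 + t * poly r (t / real l) / real l) ^ l \<le>
        det (submatrix (?M l ^\<^sub>m l) I I)) sequentially"
      using eventually_ge_at_top[of k0]
    proof eventually_elim
      case (elim l)
      then show ?case
        using principal_minor_pow_ge[OF k0(2) M I, of l] k0(1) by (simp add: sub r)
    qed
    ultimately show ?thesis
      by (rule limit_pos_if_power_le[OF u])
  qed
  then show ?thesis
    using assms(1) by (auto simp: EP_matrix_def P_matrix_def mat_exp_def)
qed

end
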